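(* Let $n,m$ be positive integers, let $S\subseteq S_n$ be a subset of the symmetric group containing the identity, and let $G\le S_n$ be the subgroup generated by $S$. The player can win the $(S,m)$-game if and only if $|G|=1$, or $m=1$, or $(|G|,m)=(p^a,p^b)$ for some prime $p$ and positive integers $a,b$.
   Context: The $(S,m)$-game: $n$ counters sit at positions $1,\dots,n$ (labels fixed from the player's perspective), each showing an element of $\mathbb{Z}_m$, so a configuration is a vector in $\mathbb{Z}_m^n$. The initial configuration is arbitrary and unknown to the player. Each turn the player chooses a move $y\in\mathbb{Z}_m^n$, added coordinatewise to the configuration; then an arbitrary, adversarially chosen permutation $\sigma\in S$ (possibly different each turn) is applied to the counters: the configuration $x$ is replaced by $x'$ with $x'_{\sigma(i)}=x_i$ for all $i$. The player wins if at some moment (including initially) all counters show $0$. A strategy is a finite sequence of moves $y_1,\dots,y_N$ (the player receives no information); it is winning if for every initial configuration and every choice of permutations the configuration equals the zero vector at some time. "The player can win" means a winning finite sequence exists. *)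

theory Defs
  imports "HOL-Algebra.Sym_Groups" "HOL-Computational_Algebra.Primes"
begin

text \<open>Counters are at positions 1..n; a configuration in Z_m^n is a function
  nat => nat with values < m on {1..n} and value 0 outside {1..n}.\<close>

definition valid_config :: "nat \<Rightarrow> nat \<Rightarrow> (nat \<Rightarrow> nat) \<Rightarrow> bool" where
  "valid_config n m x \<longleftrightarrow> (\<forall>i\<in>{1..n}. x i < m) \<and> (\<forall>i. i \<notin> {1..n} \<longrightarrow> x i = 0)"

definition add_config :: "nat \<Rightarrow> (nat \<Rightarrow> nat) \<Rightarrow> (nat \<Rightarrow> nat) \<Rightarrow> (nat \<Rightarrow> nat)" where
  "add_config m x y = (\<lambda>i. (x i + y i) mod m)"

text \<open>Applying sigma: x' (sigma i) = x i, i.e. x' = x o inv sigma.\<close>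
definition perm_config :: "(nat \<Rightarrow> nat) \<Rightarrow> (nat \<Rightarrow> nat) \<Rightarrow> (nat \<Rightarrow> nat)" where
  "perm_config s x = x \<circ> Hilbert_Choice.inv s"

fun states :: "nat \<Rightarrow> (nat \<Rightarrow> nat) \<Rightarrow> (nat \<Rightarrow> nat) list \<Rightarrow> (nat \<Rightarrow> nat) list
      \<Rightarrow> (nat \<Rightarrow> nat) list" where
  "states m x (y # ys) (s # ss) = x # states m (perm_config s (add_config m x y)) ys ss"
| "states m x _ _ = [x]"

definition winning_strategy :: "nat \<Rightarrow> nat \<Rightarrow> (nat \<Rightarrow> nat) set \<Rightarrow> (nat \<Rightarrow> nat) list \<Rightarrow> bool" where
  "winning_strategy n m S ys \<longleftrightarrow>
     (\<forall>y\<in>set ys. valid_config n m y) \<and>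
     (\<forall>x ss. valid_config n m x \<and> length ss = length ys \<and> set ss \<subseteq> S
         \<longrightarrow> (\<lambda>_. 0) \<in> set (states m x ys ss))"

definition player_can_win :: "nat \<Rightarrow> nat \<Rightarrow> (nat \<Rightarrow> nat) set \<Rightarrow> bool" where
  "player_can_win n m S \<longleftrightarrow> (\<exists>ys. winning_strategy n m S ys)"

end

theory Submission
  imports Defs "HOL-Algebra.Multiplicative_Group" "HOL-Algebra.Sylow" "HOL-Algebra.Group_Action" "HOL-Number_Theory.Cong"
begin

text \<open>
  Let \<open>V\<close> be the group of configurations. The player wins iff \<open>V\<close> is the only \<open>S\<close>-stable subgroup
  \<open>U\<close> for which \<open>V/U\<close> has no nonzero \<open>S\<close>-fixed element.

  If such a \<open>U\<close> is proper, every configuration outside \<open>U\<close> can be pulled back through any move to a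
  configuration outside \<open>U\<close>: otherwise all its \<open>S\<close>-translates would agree modulo \<open>U\<close>. So the adversary
  stays outside \<open>U\<close>. Conversely, a strategy \<open>w\<close> for \<open>U\<close> and an element \<open>v\<close> that is fixed modulo \<open>U\<close>
  give the strategy \<open>w, v, w, v, \<dots>, w\<close> for the subgroup spanned by \<open>U\<close> and \<open>v\<close>.

  If \<open>|G|\<close> and \<open>m\<close> are powers of \<open>p\<close>, counting fixed points modulo \<open>p\<close> gives a nonzero fixed element in
  every nontrivial \<open>V/U\<close>. If instead a prime \<open>q\<close> divides \<open>m\<close> and a prime \<open>r \<noteq> q\<close> divides \<open>|G|\<close>, the
  vectors fixed modulo \<open>q\<close> by all \<open>h\<close> in \<open>G\<close> with \<open>h\<^sup>r = 1\<close> form a proper subgroup of the above kind.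
\<close>

section \<open>Finite groups and group actions\<close>

text \<open>Orbit sizes divide \<open>p ^ a\<close>, so every orbit that is not a single fixed point
  has size divisible by \<open>p\<close>; only the fixed points survive modulo
  \<open>p\<close>.\<close>

lemma (in group_action) p_group_card_fixed_points_cong:
  assumes "finite E" "prime p" "order G = p ^ a"
  shows "[card {x \<in> E. \<forall>g\<in>carrier G. \<phi> g x = x} = card E] (mod p)"
proof -
  let ?F = "{x \<in> E. \<forall>g\<in>carrier G. \<phi> g x = x}" and ?O = "orbits G E \<phi>"
  let ?O1 = "(\<lambda>x. {x}) ` ?F"
  have orbit_sub: "orbit G \<phi> x \<subseteq> E" if "x \<in> E" for x
    using that element_image by (auto simp: orbit_def)
  have finO: "finite ?O"
    using assms(1) by (simp add: orbits_def)
  have sing: "orbit G \<phi> x = {x}" if "x \<in> ?F" for x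
  proof -
    have "\<phi> g x = x" if "g \<in> carrier G" for g
      using that \<open>x \<in> ?F\<close> by blast
    then have "orbit G \<phi> x \<subseteq> {x}"
      by (auto simp: orbit_def)
    then show ?thesis
      using orbit_refl[of x] that by blast
  qed
  have sub: "?O1 \<subseteq> ?O"
    unfolding orbits_def using sing by blast
  have dvd: "p dvd card orb" if orb: "orb \<in> ?O - ?O1" for orb
  proof -
    obtain x where x: "x \<in> E" "orb = orbit G \<phi> x"
      using orb by (auto simp: orbits_def)
    have "card orb dvd p ^ a"
      using orbit_stabilizer_theorem[OF x(1)] assms(3) x(2) by (metis dvd_triv_left)
    then obtain i where i: "card orb = p ^ i"
      using assms(2) divides_primepow_nat by blast
    have "card orb \<noteq> 1"
    proof
      assume "card orb = 1"
      then have o: "orb = {x}"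
        using orbit_refl[OF x(1)] x(2) by (metis card_1_singletonE singletonD)
      then have "x \<in> ?F"
        using x by (auto simp: orbit_def)
      then show False
        using o orb by blast
    qed
    then show ?thesis
      using i by (cases i) auto
  qed
  have "card E = (\<Sum>orb\<in>?O. card orb)"
    using disjoint_sum[OF assms(1), of "\<lambda>_. 1 :: nat"] by simp
  also have "\<dots> = (\<Sum>orb\<in>?O - ?O1. card orb) + (\<Sum>orb\<in>?O1. card orb)"
    using sum.subset_diff[OF sub finO] by blast
  also have "(\<Sum>orb\<in>?O1. card orb) = card ?F"
    by (subst sum.reindex) (auto simp: inj_on_def)
  finally have "card E = (\<Sum>orb\<in>?O - ?O1. card orb) + card ?F" .
  moreover have "p dvd (\<Sum>orb\<in>?O - ?O1. card orb)"
    using dvd by (rule dvd_sum)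
  ultimately show ?thesis
    by (simp add: cong_def mod_add_eq dvd_eq_mod_eq_0 flip: mod_add_left_eq)
qed

text \<open>\<open>group_action\<close> asks for a homomorphism into \<open>BijGroup E\<close>,
  whose members are extensional on \<open>E\<close>; hence the \<open>restrict\<close>. Bijectivity
  is automatic, as \<open>f (inv g)\<close> inverts \<open>f g\<close>.\<close>

lemma group_actionI:
  fixes G (structure)
  assumes "group G"
    and closed: "\<And>g x. g \<in> carrier G \<Longrightarrow> x \<in> E \<Longrightarrow> f g x \<in> E"
    and one: "\<And>x. x \<in> E \<Longrightarrow> f \<one> x = x"
    and mult: "\<And>g h x. g \<in> carrier G \<Longrightarrow> h \<in> carrier G \<Longrightarrow> x \<in> E \<Longrightarrow> f (g \<otimes> h) x = f g (f h x)"
  shows "group_action G E (\<lambda>g. restrict (f g) E)"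
proof -
  interpret group G by fact
  have bij: "restrict (f g) E \<in> Bij E" if g: "g \<in> carrier G" for g
  proof -
    have "f (inv g) (f g x) = x" "f g (f (inv g) x) = x" if "x \<in> E" for x
      using mult[of "inv g" g x] mult[of g "inv g" x] one that g by simp_all
    then have "bij_betw (f g) E E"
      using closed g by (intro bij_betw_byWitness[where f' = "f (inv g)"]) auto
    then show ?thesis
      by (simp add: Bij_def cong: bij_betw_cong)
  qed
  have "restrict (f (g \<otimes> h)) E = compose E (restrict (f g) E) (restrict (f h) E)"
    if "g \<in> carrier G" "h \<in> carrier G" for g h
    using that closed mult by (auto simp: compose_def fun_eq_iff)
  then have "(\<lambda>g. restrict (f g) E) \<in> hom G (BijGroup E)"
    using bij by (auto simp: hom_def BijGroup_def)
  then show ?thesis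
    by (simp add: group_action_def group_hom_def group_hom_axioms_def group_BijGroup is_group)
qed

text \<open>Sylow's theorem with exponent 1 gives a subgroup of prime order \<open>r\<close>, and
  any of its nontrivial elements will do.\<close>

lemma (in group) cauchy_element:
  assumes "finite (carrier G)" "prime r" "r dvd order G"
  obtains g where "g \<in> carrier G" "g \<noteq> \<one>" "g [^] r = \<one>"
proof -
  obtain k where "order G = r ^ 1 * k"
    using assms(3) by auto
  then obtain H where H: "subgroup H G" "card H = r"
    using sylow_thm[OF assms(2) is_group _ assms(1), of 1 k] by auto
  have "card H > 1"
    using H(2) prime_gt_1_nat[OF assms(2)] by simp
  then obtain g where g: "g \<in> H" "g \<noteq> \<one>"
    by (metis card_1_singleton_iff is_singletonI' is_singleton_def less_irrefl subgroup.one_closed[OF H(1)]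
        is_singleton_altdef empty_iff)
  interpret H: group "G\<lparr>carrier := H\<rparr>"
    using H(1) by (rule subgroup_imp_group)
  have "g [^]\<^bsub>G\<lparr>carrier := H\<rparr>\<^esub> r = \<one>"
    using H.pow_order_eq_1[of g] g H(2) by (simp add: order_def)
  then have "g [^] r = \<one>"
    by (simp add: nat_pow_consistent[symmetric])
  then show thesis
    using that g subgroup.mem_carrier[OF H(1)] by blast
qed

text \<open>Closure under inverses comes from finiteness: \<open>inv x\<close> is the power of
  \<open>x\<close> with exponent \<open>order G - 1\<close>.\<close>

lemma (in group) finite_subgroupI:
  assumes "finite (carrier G)" "H \<subseteq> carrier G" "\<one> \<in> H"
    and mult: "\<And>x y. x \<in> H \<Longrightarrow> y \<in> H \<Longrightarrow> x \<otimes> y \<in> H"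
  shows "subgroup H G"
proof (rule subgroupI)
  fix x assume x: "x \<in> H"
  then have xG: "x \<in> carrier G"
    using assms(2) by blast
  have pow: "x [^] k \<in> H" for k :: nat
    by (induction k) (use assms(3) x mult in auto)
  have "order G > 0"
    using assms(1) order_gt_0_iff_finite by blast
  then have "x [^] (order G - 1) \<otimes> x = \<one>"
    using pow_order_eq_1[OF xG] by (metis Suc_diff_1 nat_pow_Suc)
  then have "inv x = x [^] (order G - 1)"
    using xG inv_equality by blast
  then show "inv x \<in> H"
    using pow by simp
qed (use assms in auto)

lemma (in group) mult_inv_telescope:
  assumes "a \<in> carrier G" "b \<in> carrier G" "c \<in> carrier G"
  shows "(a \<otimes> inv b) \<otimes> (b \<otimes> inv c) = a \<otimes> inv c"
proof -
  have "inv b \<otimes> (b \<otimes> inv c) = inv c"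
    using assms by (simp add: m_assoc[symmetric])
  then show ?thesis
    using assms by (simp add: m_assoc)
qed

lemma (in group) mult_inv_cancel_right:
  assumes "a \<in> carrier G" "b \<in> carrier G" "c \<in> carrier G"
  shows "(a \<otimes> inv c) \<otimes> inv (b \<otimes> inv c) = a \<otimes> inv b"
proof -
  have "inv (b \<otimes> inv c) = c \<otimes> inv b"
    using assms by (simp add: inv_mult_group)
  then show ?thesis
    using assms by (simp add: mult_inv_telescope)
qed

section \<open>The group of configurations and the permutations acting on it\<close>

definition config_group :: "nat \<Rightarrow> nat \<Rightarrow> (nat \<Rightarrow> nat) monoid" where
  "config_group n m = \<lparr>carrier = Collect (valid_config n m), mult = add_config m, one = (\<lambda>_. 0)\<rparr>"

lemma config_group_simps:
  "x \<in> carrier (config_group n m) \<longleftrightarrow> valid_config n m x"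
  "x \<otimes>\<^bsub>config_group n m\<^esub> y = add_config m x y"
  "\<one>\<^bsub>config_group n m\<^esub> = (\<lambda>_. 0)"
  by (simp_all add: config_group_def)

lemma valid_config_less: "valid_config n m x \<Longrightarrow> m > 0 \<Longrightarrow> x i < m"
  by (cases "i \<in> {1..n}") (auto simp: valid_config_def)

lemma comm_group_config_group:
  assumes "m > 0"
  shows "comm_group (config_group n m)"
proof (rule comm_groupI; simp add: config_group_simps)
  fix x assume x: "valid_config n m x"
  \<comment> \<open>The outer \<open>mod m\<close> matters where \<open>x i = 0\<close>, in
    particular outside \<open>{1..n}\<close>: it sends \<open>m\<close> to \<open>0\<close>.\<close>
  let ?y = "\<lambda>i. (m - x i) mod m"
  have "add_config m ?y x = (\<lambda>_. 0)"
    by (simp add: add_config_def fun_eq_iff mod_add_left_eq less_imp_le valid_config_less[OF x assms])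
  moreover have "valid_config n m ?y"
    using x assms by (auto simp: valid_config_def)
  ultimately show "\<exists>y\<in>carrier (config_group n m). add_config m y x = (\<lambda>_. 0)"
    by (intro bexI[of _ ?y]) (simp_all add: config_group_simps)
next
  fix x assume "valid_config n m x"
  then show "add_config m (\<lambda>_. 0) x = x"
    using valid_config_less assms by (auto simp: add_config_def fun_eq_iff)
qed (use assms in \<open>auto simp: valid_config_def add_config_def fun_eq_iff mod_add_left_eq mod_add_right_eq ac_simps\<close>)

text \<open>Configurations and extensional functions differ only in the default value outside
  \<open>{1..n}\<close>, \<open>0\<close> versus \<open>undefined\<close>; so finiteness and
  cardinality carry over.\<close>

lemma config_group_carrier_conv_PiE:
  "bij_betw (\<lambda>x. restrict x {1..n}) (carrier (config_group n m)) ({1..n} \<rightarrow>\<^sub>E {..<m})"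
  by (rule bij_betw_byWitness[where f' = "\<lambda>f i. if i \<in> {1..n} then f i else 0"])
     (auto simp: config_group_simps valid_config_def fun_eq_iff PiE_def extensional_def)

lemma finite_config_group: "finite (carrier (config_group n m))"
  using bij_betw_finite[OF config_group_carrier_conv_PiE[of n m]]
  by (simp add: finite_PiE)

lemma order_config_group: "order (config_group n m) = m ^ n"
  using bij_betw_same_card[OF config_group_carrier_conv_PiE[of n m]]
  by (simp add: card_PiE order_def)

lemma perm_config_id [simp]: "perm_config id x = x" "perm_config (\<lambda>i. i) x = x"
  by (simp_all add: perm_config_def flip: id_def)

lemma perm_config_comp:
  "bij s \<Longrightarrow> bij t \<Longrightarrow> perm_config (s \<circ> t) x = perm_config s (perm_config t x)"
  by (simp add: perm_config_def o_inv_distrib comp_assoc)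

lemma valid_perm_config:
  assumes "s permutes {1..n}" "valid_config n m x"
  shows "valid_config n m (perm_config s x)"
  using assms permutes_in_image[OF permutes_inv[OF assms(1)]]
  unfolding valid_config_def perm_config_def o_def by blast

lemma perm_config_add: "perm_config s (add_config m x y) = add_config m (perm_config s x) (perm_config s y)"
  by (auto simp: perm_config_def add_config_def)

section \<open>Splitting plays, and invariants of plays\<close>

lemma states_nonempty [simp]: "states m x ys ss \<noteq> []"
  by (cases "(m, x, ys, ss)" rule: states.cases) auto

text \<open>The configuration where the two segments meet ends the first list and begins the second,
  so the equation is stated for sets and not for lists.\<close>

lemma set_states_append:
  assumes "length ss = length ys"
  shows "set (states m x (ys @ zs) (ss @ ts))
    = set (states m x ys ss) \<union> set (states m (last (states m x ys ss)) zs ts)"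
proof -
  have first: "x \<in> set (states m x zs ts)" for x
    by (cases "(m, x, zs, ts)" rule: states.cases) auto
  show ?thesis
    using assms
  proof (induction ss ys arbitrary: x rule: list_induct2)
    case Nil
    then show ?case
      using first[of x] by auto
  qed auto
qed

lemma last_states_invariant:
  assumes "x \<in> P" and step: "\<And>x y s. x \<in> P \<Longrightarrow> y \<in> Y \<Longrightarrow> s \<in> S \<Longrightarrow> perm_config s (add_config m x y) \<in> P"
    and "set ys \<subseteq> Y" "set ss \<subseteq> S"
  shows "last (states m x ys ss) \<in> P"
  using assms(1,3,4)
proof (induction ys arbitrary: x ss)
  case (Cons y ys)
  then show ?case
    by (cases ss) (auto intro: step)
qed simp

section \<open>Stable subgroups and elements fixed modulo them\<close>

locale counter_game =
  fixes n m :: nat and S :: "(nat \<Rightarrow> nat) set"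
  assumes m_pos: "m > 0"
    and S_perms: "S \<subseteq> carrier (sym_group n)"
    and id_S: "id \<in> S"
begin

abbreviation V where "V \<equiv> config_group n m"
abbreviation G where "G \<equiv> generate (sym_group n) S"

sublocale V: comm_group V
  using m_pos by (rule comm_group_config_group)

lemma subgroup_G: "subgroup G (sym_group n)"
  using S_perms by (rule group.generate_is_subgroup[OF sym_group_is_group])

lemma permutes_G: "g \<in> G \<Longrightarrow> g permutes {1..n}"
  using subgroup.subset[OF subgroup_G] sym_group_carrier by blast

lemma finite_G: "finite G"
  by (rule finite_subset[OF _ finite_permutations[of "{1..n}"]]) (auto dest: permutes_G)

lemma S_subset_G: "S \<subseteq> G"
  by (simp add: generate.incl subsetI)

lemma comp_G: "g \<in> G \<Longrightarrow> h \<in> G \<Longrightarrow> g \<circ> h \<in> G"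
  using generate.eng[of g "sym_group n" S h] by (simp add: sym_group_mult)

lemma inv_G: "g \<in> G \<Longrightarrow> inv' g \<in> G"
  using subgroup.m_inv_closed[OF subgroup_G] subgroup.mem_carrier[OF subgroup_G] by fastforce

lemma bij_G: "g \<in> G \<Longrightarrow> bij g"
  using permutes_G permutes_bij by blast

lemma perm_config_inv [simp]:
  "g \<in> G \<Longrightarrow> perm_config (inv' g) (perm_config g x) = x"
  "g \<in> G \<Longrightarrow> perm_config g (perm_config (inv' g) x) = x"
proof -
  assume g: "g \<in> G"
  then have "inv' g \<circ> g = id" "g \<circ> inv' g = id"
    using permutes_G permutes_inv_o by blast+
  then show "perm_config (inv' g) (perm_config g x) = x" "perm_config g (perm_config (inv' g) x) = x"
    using perm_config_comp[OF bij_imp_bij_inv bij_G, of g g x]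
      perm_config_comp[OF bij_G bij_imp_bij_inv, of g g x] bij_G[OF g] g by simp_all
qed

lemma perm_config_closed [simp]:
  "g \<in> G \<Longrightarrow> x \<in> carrier V \<Longrightarrow> perm_config g x \<in> carrier V"
  using valid_perm_config permutes_G by (simp add: config_group_simps)

lemma perm_config_mult [simp]:
  "perm_config g (x \<otimes>\<^bsub>V\<^esub> y) = perm_config g x \<otimes>\<^bsub>V\<^esub> perm_config g y"
  by (simp add: config_group_simps perm_config_add)

lemma group_hom_perm_config:
  "g \<in> G \<Longrightarrow> group_hom V V (perm_config g)"
  by (unfold_locales) (simp add: hom_def)

lemma perm_config_m_inv [simp]:
  "g \<in> G \<Longrightarrow> x \<in> carrier V \<Longrightarrow> perm_config g (inv\<^bsub>V\<^esub> x) = inv\<^bsub>V\<^esub> (perm_config g x)"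
  using group_hom.hom_inv[OF group_hom_perm_config] by blast

lemma perm_config_pow [simp]:
  "g \<in> G \<Longrightarrow> x \<in> carrier V \<Longrightarrow> perm_config g (x [^]\<^bsub>V\<^esub> (k::nat)) = perm_config g x [^]\<^bsub>V\<^esub> k"
  using group_hom.hom_nat_pow[OF group_hom_perm_config] by blast

definition stable :: "(nat \<Rightarrow> nat) set \<Rightarrow> bool" where
  "stable U \<longleftrightarrow> subgroup U V \<and> (\<forall>s\<in>S. \<forall>u\<in>U. perm_config s u \<in> U)"

text \<open>For stable \<open>U\<close> this is the preimage in \<open>V\<close> of the fixed
  elements of the quotient by \<open>U\<close>. Working with differences avoids forming the
  quotient; \<open>fixed_mod U \<subseteq> U\<close> says that it has no nonzero fixed
  element.\<close>

definition fixed_mod :: "(nat \<Rightarrow> nat) set \<Rightarrow> (nat \<Rightarrow> nat) set" where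
  "fixed_mod U = {v \<in> carrier V. \<forall>s\<in>S. perm_config s v \<otimes>\<^bsub>V\<^esub> inv\<^bsub>V\<^esub> v \<in> U}"

text \<open>The point is the inverses of elements of \<open>S\<close>: \<open>h\<close> acts
  injectively on the finite set \<open>U\<close>, hence maps it onto itself, so its inverse
  preserves \<open>U\<close> too.\<close>

lemma stable_perm_config_G:
  assumes "stable U" "g \<in> G" "u \<in> U"
  shows "perm_config g u \<in> U"
  using assms(2,3)
proof (induction g arbitrary: u rule: generate.induct)
  case one
  then show ?case by (simp add: sym_group_one)
next
  case (incl h)
  then show ?case using assms(1) by (simp add: stable_def)
next
  case (inv h)
  have "h \<in> G" "h \<in> carrier (sym_group n)"
    using inv(1) S_subset_G S_perms by auto
  have "finite U"
    using assms(1) subgroup.subset finite_config_group finite_subset unfolding stable_def by metis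
  moreover have "inj_on (perm_config h) U"
    using \<open>h \<in> G\<close> by (metis inj_onI perm_config_inv(1))
  ultimately have "perm_config h ` U = U"
    using assms(1) inv(1) by (intro endo_inj_surj) (auto simp: stable_def)
  then have "u \<in> perm_config h ` U"
    using inv(2) by simp
  then have "perm_config (inv' h) u \<in> U"
    using perm_config_inv(1)[OF \<open>h \<in> G\<close>] by auto
  then show ?case
    using sym_group_inv_equality[OF \<open>h \<in> carrier (sym_group n)\<close>] by metis
next
  case (eng g h)
  then have "perm_config (g \<circ> h) u \<in> U"
    by (subst perm_config_comp) (auto intro: bij_G)
  then show ?case
    by (simp only: sym_group_mult)
qed

text \<open>Induction over words in the generators, since
  \<open>(g h) v - v = g (h v - v) + (g v - v)\<close>. For the inverse of \<open>h\<close>, apply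
  it to \<open>h v - v\<close> and negate.\<close>

lemma fixed_mod_perm_config_G:
  assumes "stable U" "v \<in> fixed_mod U" "g \<in> G"
  shows "perm_config g v \<otimes>\<^bsub>V\<^esub> inv\<^bsub>V\<^esub> v \<in> U"
  using assms(3)
proof (induction g rule: generate.induct)
  case one
  have "perm_config id v \<otimes>\<^bsub>V\<^esub> inv\<^bsub>V\<^esub> v \<in> U"
    using assms(2) id_S unfolding fixed_mod_def by blast
  then show ?case
    by (simp only: sym_group_one)
next
  case (incl h)
  then show ?case using assms by (simp add: fixed_mod_def)
next
  case (inv h)
  have h: "h \<in> G" "h \<in> carrier (sym_group n)"
    using inv(1) S_subset_G S_perms by auto
  have v: "v \<in> carrier V"
    using assms(2) by (simp add: fixed_mod_def)
  have "perm_config h v \<otimes>\<^bsub>V\<^esub> inv\<^bsub>V\<^esub> v \<in> U"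
    using inv assms(2) by (simp add: fixed_mod_def)
  then have "perm_config (inv' h) (perm_config h v \<otimes>\<^bsub>V\<^esub> inv\<^bsub>V\<^esub> v) \<in> U"
    using stable_perm_config_G[OF assms(1) inv_G[OF h(1)]] by blast
  then have "v \<otimes>\<^bsub>V\<^esub> inv\<^bsub>V\<^esub> (perm_config (inv' h) v) \<in> U"
    using v h inv_G by simp
  then have "inv\<^bsub>V\<^esub> (v \<otimes>\<^bsub>V\<^esub> inv\<^bsub>V\<^esub> (perm_config (inv' h) v)) \<in> U"
    using assms(1) subgroup.m_inv_closed unfolding stable_def by metis
  then show ?case
    using h v inv_G by (simp add: V.inv_mult V.m_comm)
next
  case (eng g h)
  have v: "v \<in> carrier V"
    using assms(2) by (simp add: fixed_mod_def)
  have "perm_config g (perm_config h v \<otimes>\<^bsub>V\<^esub> inv\<^bsub>V\<^esub> v) \<otimes>\<^bsub>V\<^esub> (perm_config g v \<otimes>\<^bsub>V\<^esub> inv\<^bsub>V\<^esub> v) \<in> U"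
    using eng stable_perm_config_G[OF assms(1)] assms(1) by (meson stable_def subgroup.m_closed)
  moreover have "perm_config g (perm_config h v \<otimes>\<^bsub>V\<^esub> inv\<^bsub>V\<^esub> v) \<otimes>\<^bsub>V\<^esub> (perm_config g v \<otimes>\<^bsub>V\<^esub> inv\<^bsub>V\<^esub> v)
      = perm_config (g \<circ> h) v \<otimes>\<^bsub>V\<^esub> inv\<^bsub>V\<^esub> v"
    using eng(1,2) v perm_config_comp[OF bij_G bij_G, of g h v] by (simp add: V.mult_inv_telescope)
  ultimately show ?case
    by (simp only: sym_group_mult)
qed

section \<open>Evasion by the adversary\<close>

text \<open>The play is built backwards: one that avoids \<open>U\<close> during the remaining moves
  is extended at its start, so the initial configuration is settled last.\<close>

lemma adversary_avoids:
  assumes U: "stable U" "fixed_mod U \<subseteq> U" "U \<noteq> carrier V" and "set ys \<subseteq> carrier V"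
  shows "\<exists>x\<in>carrier V - U. \<exists>ss. length ss = length ys \<and> set ss \<subseteq> S \<and> set (states m x ys ss) \<inter> U = {}"
  using assms(4)
proof (induction ys)
  case Nil
  obtain x where "x \<in> carrier V - U"
    using U(1,3) subgroup.subset unfolding stable_def by blast
  then show ?case
    by (intro bexI[of _ x] exI[of _ "[]"]) auto
next
  case (Cons y ys)
  interpret U: subgroup U V
    using U(1) by (simp add: stable_def)
  obtain x ss where x: "x \<in> carrier V - U"
    and ss: "length ss = length ys" "set ss \<subseteq> S" "set (states m x ys ss) \<inter> U = {}"
    using Cons by auto
  have y: "y \<in> carrier V"
    using Cons.prems by simp
  obtain s where s: "s \<in> S" "perm_config s x \<otimes>\<^bsub>V\<^esub> inv\<^bsub>V\<^esub> x \<notin> U"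
    using x U(2) by (auto simp: fixed_mod_def)
  then have sG: "s \<in> G"
    using S_subset_G by blast
  \<comment> \<open>\<open>f t\<close> is the one configuration that the move \<open>y\<close>
    followed by \<open>t\<close> takes to \<open>x\<close>.\<close>
  define f where "f t = perm_config (inv' t) x \<otimes>\<^bsub>V\<^esub> inv\<^bsub>V\<^esub> y" for t
  \<comment> \<open>The move \<open>y\<close> cancels in the difference of \<open>f s\<close> and
    \<open>f id\<close>. If both lay in \<open>U\<close>, applying \<open>s\<close> to this
    difference and negating would put \<open>s x - x\<close> in \<open>U\<close>.\<close>
  have "f s \<notin> U \<or> f id \<notin> U"
  proof (rule ccontr)
    assume "\<not> ?thesis"
    then have "f s \<otimes>\<^bsub>V\<^esub> inv\<^bsub>V\<^esub> (f id) \<in> U"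
      by simp
    moreover have "f s \<otimes>\<^bsub>V\<^esub> inv\<^bsub>V\<^esub> (f id) = perm_config (inv' s) x \<otimes>\<^bsub>V\<^esub> inv\<^bsub>V\<^esub> x"
      using x y sG inv_G by (simp add: f_def V.mult_inv_cancel_right)
    ultimately have "perm_config s (perm_config (inv' s) x \<otimes>\<^bsub>V\<^esub> inv\<^bsub>V\<^esub> x) \<in> U"
      using stable_perm_config_G[OF U(1) sG] by metis
    then have "inv\<^bsub>V\<^esub> (x \<otimes>\<^bsub>V\<^esub> inv\<^bsub>V\<^esub> (perm_config s x)) \<in> U"
      using x sG by simp
    then show False
      using s(2) x sG by (simp add: V.inv_mult V.m_comm)
  qed
  then obtain t where t: "t \<in> S" "f t \<notin> U"
    using s(1) id_S by blast
  then have tG: "t \<in> G"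
    using S_subset_G by blast
  have "f t \<in> carrier V"
    using x y tG inv_G by (simp add: f_def)
  moreover have "perm_config t (add_config m (f t) y) = x"
  proof -
    have "add_config m (f t) y = f t \<otimes>\<^bsub>V\<^esub> y"
      by (simp add: config_group_simps)
    also have "\<dots> = perm_config (inv' t) x"
      using x y tG inv_G by (simp add: f_def V.m_assoc)
    finally show ?thesis
      using tG by simp
  qed
  ultimately show ?case
    using t ss by (intro bexI[of _ "f t"] exI[of _ "t # ss"]) auto
qed

lemma player_can_win_imp_no_proper_closed:
  assumes "player_can_win n m S" "stable U" "fixed_mod U \<subseteq> U"
  shows "U = carrier V"
proof (rule ccontr)
  assume "U \<noteq> carrier V"
  obtain ys where ys: "winning_strategy n m S ys"
    using assms(1) by (auto simp: player_can_win_def)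
  then have "set ys \<subseteq> carrier V"
    by (auto simp: winning_strategy_def config_group_simps)
  then obtain x ss where "x \<in> carrier V" "length ss = length ys" "set ss \<subseteq> S"
      "set (states m x ys ss) \<inter> U = {}"
    using adversary_avoids[OF assms(2,3) \<open>U \<noteq> carrier V\<close>] by blast
  moreover have "(\<lambda>_. 0) \<in> set (states m x ys ss)"
    using ys calculation by (auto simp: winning_strategy_def config_group_simps)
  moreover have "(\<lambda>_. 0) \<in> U"
    using assms(2) subgroup.one_closed[of U V] by (simp add: stable_def config_group_simps)
  ultimately show False
    by blast
qed

section \<open>Strategies built up along a chain of stable subgroups\<close>

text \<open>Moves are confined to \<open>U\<close> so that a run of \<open>ys\<close> never leaves
  an \<open>S\<close>-fixed coset of \<open>U\<close>; this makes a strategy for \<open>U\<close>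
  usable as a block inside a longer one.\<close>

definition winnable :: "(nat \<Rightarrow> nat) set \<Rightarrow> bool" where
  "winnable U \<longleftrightarrow> stable U \<and> (\<exists>ys. set ys \<subseteq> U \<and>
     (\<forall>x\<in>U. \<forall>ss. length ss = length ys \<and> set ss \<subseteq> S \<longrightarrow> (\<lambda>_. 0) \<in> set (states m x ys ss)))"

lemma winnable_one: "winnable {\<one>\<^bsub>V\<^esub>}"
  unfolding winnable_def
proof (intro conjI exI[of _ "[]"])
  show "stable {\<one>\<^bsub>V\<^esub>}"
    using V.triv_subgroup by (auto simp: stable_def config_group_simps perm_config_def)
qed (auto simp: config_group_simps)

text \<open>The coset \<open>U - j v\<close>, from which \<open>j\<close> moves \<open>v\<close>
  lead into \<open>U\<close>. Over all \<open>j\<close> these cosets make up the subgroup spanned by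
  \<open>U\<close> and \<open>v\<close>.\<close>

definition reaching_coset :: "(nat \<Rightarrow> nat) set \<Rightarrow> (nat \<Rightarrow> nat) \<Rightarrow> nat \<Rightarrow> (nat \<Rightarrow> nat) set" where
  "reaching_coset U v j = {x \<in> carrier V. x \<otimes>\<^bsub>V\<^esub> v [^]\<^bsub>V\<^esub> j \<in> U}"

lemma reaching_coset_0: "subgroup U V \<Longrightarrow> reaching_coset U v 0 = U"
  by (auto simp: reaching_coset_def subgroup.mem_carrier)

lemma reaching_coset_mult:
  assumes "subgroup U V" "v \<in> carrier V" "x \<in> reaching_coset U v i" "y \<in> reaching_coset U v j"
  shows "x \<otimes>\<^bsub>V\<^esub> y \<in> reaching_coset U v (i + j)"
proof -
  have "(x \<otimes>\<^bsub>V\<^esub> y) \<otimes>\<^bsub>V\<^esub> v [^]\<^bsub>V\<^esub> (i + j) = (x \<otimes>\<^bsub>V\<^esub> v [^]\<^bsub>V\<^esub> i) \<otimes>\<^bsub>V\<^esub> (y \<otimes>\<^bsub>V\<^esub> v [^]\<^bsub>V\<^esub> j)"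
    using assms(2-4) by (simp add: reaching_coset_def V.m_ac flip: V.nat_pow_mult)
  then show ?thesis
    using assms by (simp add: reaching_coset_def subgroup.m_closed)
qed

lemma reaching_coset_move:
  assumes "v \<in> carrier V" "x \<in> reaching_coset U v (Suc j)"
  shows "x \<otimes>\<^bsub>V\<^esub> v \<in> reaching_coset U v j"
  using assms unfolding reaching_coset_def by (simp add: V.m_assoc V.m_comm[of v])

text \<open>With \<open>u = s v - v\<close> in \<open>U\<close>, the configuration
  \<open>s (x + j v)\<close> equals \<open>(s x + j v) + j u\<close>, and \<open>j u\<close> lies in
  \<open>U\<close>.\<close>

lemma reaching_coset_perm_config:
  assumes "stable U" "v \<in> fixed_mod U" "s \<in> S" "x \<in> reaching_coset U v j"
  shows "perm_config s x \<in> reaching_coset U v j"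
proof -
  interpret U: subgroup U V
    using assms(1) by (simp add: stable_def)
  have sG: "s \<in> G"
    using assms(3) S_subset_G by blast
  have v: "v \<in> carrier V" and x: "x \<in> carrier V"
    using assms by (auto simp: fixed_mod_def reaching_coset_def)
  define u where "u = perm_config s v \<otimes>\<^bsub>V\<^esub> inv\<^bsub>V\<^esub> v"
  have u: "u \<in> U"
    using assms(2,3) by (simp add: fixed_mod_def u_def)
  then have uj: "u [^]\<^bsub>V\<^esub> j \<in> U"
    by (induction j) auto
  have "perm_config s v = u \<otimes>\<^bsub>V\<^esub> v"
    using v sG by (simp add: u_def V.m_assoc)
  then have "perm_config s v = v \<otimes>\<^bsub>V\<^esub> u"
    using v u by (simp add: V.m_comm)
  then have "perm_config s (x \<otimes>\<^bsub>V\<^esub> v [^]\<^bsub>V\<^esub> j) = (perm_config s x \<otimes>\<^bsub>V\<^esub> v [^]\<^bsub>V\<^esub> j) \<otimes>\<^bsub>V\<^esub> u [^]\<^bsub>V\<^esub> j"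
    using v x sG u by (simp add: V.nat_pow_distrib V.m_assoc)
  moreover have "perm_config s (x \<otimes>\<^bsub>V\<^esub> v [^]\<^bsub>V\<^esub> j) \<in> U"
    using assms(4) stable_perm_config_G[OF assms(1) sG] by (simp only: reaching_coset_def mem_Collect_eq)
  ultimately have "(perm_config s x \<otimes>\<^bsub>V\<^esub> v [^]\<^bsub>V\<^esub> j) \<otimes>\<^bsub>V\<^esub> u [^]\<^bsub>V\<^esub> j \<otimes>\<^bsub>V\<^esub> inv\<^bsub>V\<^esub> (u [^]\<^bsub>V\<^esub> j) \<in> U"
    using uj by (metis U.m_closed U.m_inv_closed)
  then show ?thesis
    using x v sG u uj by (simp add: reaching_coset_def V.m_assoc)
qed

text \<open>There are \<open>k\<close> moves \<open>v\<close> and \<open>k + 1\<close> blocks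
  \<open>ys\<close>, one block for each possible index \<open>j \<le> k\<close>.\<close>

primrec rounds :: "'a list \<Rightarrow> 'a \<Rightarrow> nat \<Rightarrow> 'a list" where
  "rounds ys v 0 = ys"
| "rounds ys v (Suc k) = ys @ v # rounds ys v k"

lemma set_rounds: "set (rounds ys v k) \<subseteq> insert v (set ys)"
  by (induction k) auto

text \<open>A block \<open>ys\<close> keeps the index \<open>j\<close> of the coset and each move
  \<open>v\<close> lowers it by one. At index \<open>0\<close> the play is in \<open>U\<close> and
  the next block reaches zero, whatever follows. The player need not know \<open>j\<close>.\<close>

lemma rounds_win:
  assumes U: "stable U" and v: "v \<in> fixed_mod U" and ys: "set ys \<subseteq> U"
    and win: "\<And>x ss. x \<in> U \<Longrightarrow> length ss = length ys \<Longrightarrow> set ss \<subseteq> S \<Longrightarrow> (\<lambda>_. 0) \<in> set (states m x ys ss)"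
    and "x \<in> reaching_coset U v j" "j \<le> k" "length ss = length (rounds ys v k)" "set ss \<subseteq> S"
  shows "(\<lambda>_. 0) \<in> set (states m x (rounds ys v k) ss)"
  using assms(5-)
proof (induction k arbitrary: x j ss)
  case 0
  then show ?case
    using win reaching_coset_0 U by (simp add: stable_def)
next
  case (Suc k)
  have subU: "subgroup U V"
    using U by (simp add: stable_def)
  have vV: "v \<in> carrier V"
    using v by (simp add: fixed_mod_def)
  define ss1 where "ss1 = take (length ys) ss"
  have len1: "length ss1 = length ys" and S1: "set ss1 \<subseteq> S"
    using Suc.prems set_take_subset[of "length ys" ss] by (auto simp: ss1_def)
  obtain s ss2 where ss: "ss = ss1 @ s # ss2"
    using Suc.prems(3) append_take_drop_id[of "length ys" ss, symmetric]
    unfolding ss1_def by (cases "drop (length ys) ss") auto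
  define x' where "x' = last (states m x ys ss1)"
  have set_states: "set (states m x (rounds ys v (Suc k)) ss)
      = set (states m x ys ss1) \<union> set (states m x' (v # rounds ys v k) (s # ss2))"
    using set_states_append[OF len1] by (simp add: ss x'_def)
  show ?case
  proof (cases j)
    case 0
    then have "x \<in> U"
      using Suc.prems(1) reaching_coset_0[OF subU] by simp
    then show ?thesis
      using win len1 S1 set_states by blast
  next
    case (Suc i)
    have "x' \<in> reaching_coset U v j"
      unfolding x'_def
    proof (rule last_states_invariant[OF Suc.prems(1) _ ys S1])
      fix z y t assume z: "z \<in> reaching_coset U v j" "y \<in> U" "t \<in> S"
      then have "z \<otimes>\<^bsub>V\<^esub> y \<in> reaching_coset U v (j + 0)"
        using reaching_coset_mult[OF subU vV] reaching_coset_0[OF subU] by blast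
      then show "perm_config t (add_config m z y) \<in> reaching_coset U v j"
        using reaching_coset_perm_config[OF U v] z(3) by (simp add: config_group_simps)
    qed
    then have "x' \<otimes>\<^bsub>V\<^esub> v \<in> reaching_coset U v i"
      using reaching_coset_move[OF vV] Suc by blast
    then have "perm_config s (add_config m x' v) \<in> reaching_coset U v i"
      using reaching_coset_perm_config[OF U v] Suc.prems(4) ss by (simp add: config_group_simps)
    then have "(\<lambda>_. 0) \<in> set (states m (perm_config s (add_config m x' v)) (rounds ys v k) ss2)"
      using Suc Suc.prems ss len1 by (intro Suc.IH) auto
    then show ?thesis
      using set_states by simp
  qed
qed

text \<open>The union is the subgroup spanned by \<open>U\<close> and \<open>v\<close>. Multiples of
  \<open>v\<close> repeat with period \<open>order V\<close>, so indices up to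
  \<open>order V\<close> exhaust it and \<open>order V\<close> moves \<open>v\<close>
  suffice.\<close>

lemma winnable_extend:
  assumes "winnable U" "v \<in> fixed_mod U"
  shows "winnable (\<Union>j. reaching_coset U v j)" (is "winnable ?U'")
proof -
  have U: "stable U" and subU: "subgroup U V"
    using assms(1) by (auto simp: winnable_def stable_def)
  have v: "v \<in> carrier V"
    using assms(2) by (simp add: fixed_mod_def)
  obtain ys where ys: "set ys \<subseteq> U" "\<And>x ss. x \<in> U \<Longrightarrow> length ss = length ys \<Longrightarrow> set ss \<subseteq> S \<Longrightarrow> (\<lambda>_. 0) \<in> set (states m x ys ss)"
    using assms(1) by (auto simp: winnable_def)
  have ord_pos: "order V > 0"
    using finite_config_group V.order_gt_0_iff_finite by blast
  have bounded: "\<exists>j\<le>order V. x \<in> reaching_coset U v j" if "x \<in> ?U'" for x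
  proof -
    obtain j where j: "x \<in> reaching_coset U v j"
      using \<open>x \<in> ?U'\<close> by blast
    have "v [^]\<^bsub>V\<^esub> (order V * (j div order V)) = \<one>\<^bsub>V\<^esub>"
      using V.pow_order_eq_1[OF v] by (metis V.nat_pow_one V.nat_pow_pow v)
    then have "v [^]\<^bsub>V\<^esub> (order V * (j div order V) + j mod order V) = v [^]\<^bsub>V\<^esub> (j mod order V)"
      using v V.nat_pow_mult[OF v] by (metis V.l_one V.nat_pow_closed)
    then have "v [^]\<^bsub>V\<^esub> j = v [^]\<^bsub>V\<^esub> (j mod order V)"
      by simp
    then have "x \<in> reaching_coset U v (j mod order V)"
      using j by (simp add: reaching_coset_def)
    then show ?thesis
      using ord_pos by (meson mod_less_divisor order.strict_implies_order)
  qed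
  have U_sub: "U \<subseteq> ?U'"
    using reaching_coset_0[OF subU] by blast
  have sub: "subgroup ?U' V"
  proof (rule V.finite_subgroupI[OF finite_config_group])
    show "?U' \<subseteq> carrier V"
      by (auto simp: reaching_coset_def)
    show "\<one>\<^bsub>V\<^esub> \<in> ?U'"
      using U_sub subgroup.one_closed[OF subU] by blast
    show "x \<otimes>\<^bsub>V\<^esub> y \<in> ?U'" if "x \<in> ?U'" "y \<in> ?U'" for x y
      using that reaching_coset_mult[OF subU v] by blast
  qed
  \<comment> \<open>The moves of the new strategy must lie in the new subgroup; \<open>v\<close> has
    index \<open>order V - 1\<close>, since \<open>order V\<close> times \<open>v\<close> is
    zero.\<close>
  have "v \<otimes>\<^bsub>V\<^esub> v [^]\<^bsub>V\<^esub> (order V - 1) = \<one>\<^bsub>V\<^esub>"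
    using V.pow_order_eq_1[OF v] ord_pos v by (metis Suc_diff_1 V.nat_pow_Suc2)
  then have "v \<in> reaching_coset U v (order V - 1)"
    using v subgroup.one_closed[OF subU] by (simp add: reaching_coset_def)
  then have "set (rounds ys v (order V)) \<subseteq> ?U'"
    using set_rounds[of ys v "order V"] ys(1) U_sub by blast
  moreover have "stable ?U'"
    using sub reaching_coset_perm_config[OF U assms(2)] unfolding stable_def by blast
  moreover have "(\<lambda>_. 0) \<in> set (states m x (rounds ys v (order V)) ss)"
    if "x \<in> ?U'" "length ss = length (rounds ys v (order V))" "set ss \<subseteq> S" for x ss
    using bounded[OF that(1)] rounds_win[OF U assms(2) ys] that(2,3) by blast
  ultimately show ?thesis
    unfolding winnable_def by blast
qed

text \<open>As \<open>V\<close> is finite, a maximal winnable \<open>U\<close> exists. Extending it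
  by an element fixed modulo \<open>U\<close> yields nothing new, so
  \<open>fixed_mod U \<subseteq> U\<close> and hence \<open>U\<close> is all of
  \<open>V\<close>.\<close>

lemma no_proper_closed_imp_player_can_win:
  assumes closed: "\<And>U. stable U \<Longrightarrow> fixed_mod U \<subseteq> U \<Longrightarrow> U = carrier V"
  shows "player_can_win n m S"
proof -
  have sub: "U \<subseteq> carrier V" if "winnable U" for U
    using that subgroup.subset by (auto simp: winnable_def stable_def)
  have "finite (Collect winnable)"
    by (rule finite_subset[of _ "Pow (carrier V)"]) (use sub finite_config_group in auto)
  moreover have "Collect winnable \<noteq> {}"
    using winnable_one by blast
  ultimately obtain U where U: "winnable U" and max: "\<And>W. winnable W \<Longrightarrow> U \<subseteq> W \<Longrightarrow> W = U"
    using finite_has_maximal[of "Collect winnable"] by auto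
  have subU: "subgroup U V"
    using U by (simp add: winnable_def stable_def)
  have "fixed_mod U \<subseteq> U"
  proof
    fix v assume v: "v \<in> fixed_mod U"
    have vV: "v \<in> carrier V"
      using v by (simp add: fixed_mod_def)
    have "U \<subseteq> (\<Union>j. reaching_coset U v j)"
      using reaching_coset_0[OF subU] by blast
    then have eq: "(\<Union>j. reaching_coset U v j) = U"
      using max winnable_extend[OF U v] by blast
    have "inv\<^bsub>V\<^esub> v \<in> reaching_coset U v 1"
      using vV subgroup.one_closed[OF subU] by (simp add: reaching_coset_def)
    then have "inv\<^bsub>V\<^esub> v \<in> U"
      using eq by blast
    then show "v \<in> U"
      using subgroup.m_inv_closed[OF subU] vV by fastforce
  qed
  then have "U = carrier V"
    using closed U by (simp add: winnable_def)
  then have "winnable (carrier V)"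
    using U by simp
  then show ?thesis
    unfolding winnable_def player_can_win_def winning_strategy_def subset_eq Ball_def config_group_simps
    by blast
qed

section \<open>The case of powers of a common prime\<close>

text \<open>This lets \<open>G\<close> act on the cosets of \<open>U\<close>; the inclusion from
  right to left rests on \<open>inv' g\<close> preserving \<open>U\<close> too.\<close>

lemma perm_config_image_rcoset:
  assumes "stable U" "g \<in> G" "x \<in> carrier V"
  shows "perm_config g ` (U #>\<^bsub>V\<^esub> x) = U #>\<^bsub>V\<^esub> perm_config g x"
proof (intro equalityI subsetI)
  fix y assume "y \<in> perm_config g ` (U #>\<^bsub>V\<^esub> x)"
  then obtain u where "u \<in> U" "y = perm_config g u \<otimes>\<^bsub>V\<^esub> perm_config g x"
    by (auto simp: r_coset_def)
  then show "y \<in> U #>\<^bsub>V\<^esub> perm_config g x"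
    using stable_perm_config_G[OF assms(1,2)] by (auto simp: r_coset_def)
next
  fix y assume "y \<in> U #>\<^bsub>V\<^esub> perm_config g x"
  then obtain u where u: "u \<in> U" "y = u \<otimes>\<^bsub>V\<^esub> perm_config g x"
    by (auto simp: r_coset_def)
  then have "y = perm_config g (perm_config (inv' g) u \<otimes>\<^bsub>V\<^esub> x)"
    using assms(2) by simp
  moreover have "perm_config (inv' g) u \<otimes>\<^bsub>V\<^esub> x \<in> U #>\<^bsub>V\<^esub> x"
    using stable_perm_config_G[OF assms(1) inv_G[OF assms(2)] u(1)] by (auto simp: r_coset_def)
  ultimately show "y \<in> perm_config g ` (U #>\<^bsub>V\<^esub> x)"
    by (rule image_eqI)
qed

text \<open>A coset of \<open>U\<close> fixed by \<open>G\<close> consists of elements of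
  \<open>fixed_mod U\<close>, so \<open>U\<close> is the only one. The number of cosets is thus 1
  modulo \<open>p\<close>, yet for proper \<open>U\<close> it is a power of \<open>p\<close> with
  positive exponent.\<close>

lemma p_group_no_proper_closed:
  assumes "prime p" "card G = p ^ a" "m = p ^ b" "stable U" "fixed_mod U \<subseteq> U"
  shows "U = carrier V"
proof (rule ccontr)
  assume proper: "U \<noteq> carrier V"
  let ?E = "rcosets\<^bsub>V\<^esub> U" and ?f = "\<lambda>g c. perm_config g ` c"
  let ?G = "sym_group n\<lparr>carrier := G\<rparr>"
  have subU: "subgroup U V"
    using assms(4) by (simp add: stable_def)
  have finE: "finite ?E"
    using V.rcosets_subset_PowG[OF subU] finite_config_group by (meson finite_Pow_iff finite_subset)
  interpret action: group_action ?G ?E "\<lambda>g. restrict (?f g) ?E"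
  proof (rule group_actionI)
    show "group ?G"
      using group.subgroup_imp_group[OF sym_group_is_group subgroup_G] .
    show "?f g c \<in> ?E" if gc: "g \<in> carrier ?G" "c \<in> ?E" for g c
    proof -
      obtain x where "x \<in> carrier V" "c = U #>\<^bsub>V\<^esub> x"
        using gc(2) by (auto simp: RCOSETS_def)
      then show ?thesis
        using gc(1) perm_config_image_rcoset[OF assms(4)] V.rcosetsI[OF subgroup.subset[OF subU]]
        by simp
    qed
    show "?f \<one>\<^bsub>?G\<^esub> c = c" if "c \<in> ?E" for c
      by (simp add: sym_group_def)
    show "?f (g \<otimes>\<^bsub>?G\<^esub> h) c = ?f g (?f h c)" if "g \<in> carrier ?G" "h \<in> carrier ?G" "c \<in> ?E" for g h c
    proof -
      have "bij g" "bij h"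
        using that bij_G by auto
      then have "perm_config (g \<circ> h) = perm_config g \<circ> perm_config h"
        by (auto simp: perm_config_comp fun_eq_iff)
      then show ?thesis
        by (simp only: image_comp monoid.simps sym_group_def partial_object.simps)
    qed
  qed
  let ?F = "{c \<in> ?E. \<forall>g\<in>carrier ?G. restrict (?f g) ?E c = c}"
  have "[card ?F = card ?E] (mod p)"
    using action.p_group_card_fixed_points_cong[OF finE assms(1)] assms(2) by (simp add: order_def)
  moreover have "?F = {U}"
  proof (intro equalityI subsetI)
    fix c assume c: "c \<in> ?F"
    then obtain x where x: "x \<in> carrier V" "c = U #>\<^bsub>V\<^esub> x"
      by (auto simp: RCOSETS_def)
    have "perm_config s x \<otimes>\<^bsub>V\<^esub> inv\<^bsub>V\<^esub> x \<in> U" if s: "s \<in> S" for s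
    proof -
      have sG: "s \<in> G"
        using s S_subset_G by blast
      then have "U #>\<^bsub>V\<^esub> perm_config s x = U #>\<^bsub>V\<^esub> x"
        using c x perm_config_image_rcoset[OF assms(4) sG x(1)] by auto
      then have "perm_config s x \<in> U #>\<^bsub>V\<^esub> x"
        using V.rcos_self[OF _ subU] sG x(1) by (metis perm_config_closed)
      then show ?thesis
        using subgroup.rcos_module[OF subU V.is_group x(1)] sG x(1) by simp
    qed
    then have "x \<in> U"
      using x(1) assms(5) by (auto simp: fixed_mod_def)
    then show "c \<in> {U}"
      using V.coset_join2[OF x(1) subU] x(2) by simp
  next
    fix c assume "c \<in> {U}"
    then have c: "c = U #>\<^bsub>V\<^esub> \<one>\<^bsub>V\<^esub>"
      using V.coset_mult_one subgroup.subset[OF subU] by simp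
    have "c \<in> ?E"
      using c V.rcosetsI[OF subgroup.subset[OF subU]] by simp
    moreover have "?f g c = c" if "g \<in> G" for g
      using perm_config_image_rcoset[OF assms(4) that V.one_closed]
        group_hom.hom_one[OF group_hom_perm_config[OF that]] c by simp
    ultimately show "c \<in> ?F"
      by simp
  qed
  ultimately have "[1 = card ?E] (mod p)"
    by simp
  moreover have "p dvd card ?E"
  proof -
    have lagr: "card ?E * card U = order V"
      using V.lagrange[OF subU] .
    then have "card ?E dvd p ^ (b * n)"
      using order_config_group assms(3) by (metis dvd_triv_left power_mult)
    then obtain i where i: "card ?E = p ^ i"
      using assms(1) divides_primepow_nat by blast
    have "i \<noteq> 0"
    proof
      assume "i = 0"
      then have "card U = card (carrier V)"
        using i lagr by (simp add: order_def)
      then show False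
        using proper card_subset_eq[OF finite_config_group subgroup.subset[OF subU]] by blast
    qed
    then show ?thesis
      using i by simp
  qed
  ultimately have "p dvd 1"
    by (meson cong_dvd_iff)
  then show False
    using assms(1) by auto
qed

section \<open>The case of different primes dividing \<open>m\<close> and the order of
  \<open>G\<close>\<close>

text \<open>Composing with \<open>h\<close> instead of its inverse gives the same set, since the
  condition on \<open>h\<close> is invariant under inversion. Outside \<open>{1..n}\<close> the
  congruence is trivial, as \<open>h\<close> fixes these points.\<close>

definition torsion_fixed_mod :: "nat \<Rightarrow> nat \<Rightarrow> (nat \<Rightarrow> nat) set" where
  "torsion_fixed_mod r q =
     {v \<in> carrier V. \<forall>h\<in>G. h ^^ r = id \<longrightarrow> (\<forall>i. [v (h i) = v i] (mod q))}"

lemma cong_mult_config: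
  assumes "q dvd m"
  shows "[(x \<otimes>\<^bsub>V\<^esub> y) i = x i + y i] (mod q)"
  using assms by (simp add: config_group_simps add_config_def cong_def mod_mod_cancel)

text \<open>Conjugation by elements of \<open>G\<close> permutes the \<open>h\<close> in
  \<open>G\<close> with \<open>h ^^ r = id\<close>, so \<open>S\<close> preserves the vectors fixed
  by all of them.\<close>

lemma stable_torsion_fixed_mod:
  assumes "q dvd m"
  shows "stable (torsion_fixed_mod r q)"
  unfolding stable_def
proof (intro conjI ballI V.finite_subgroupI[OF finite_config_group])
  show "torsion_fixed_mod r q \<subseteq> carrier V"
    by (auto simp: torsion_fixed_mod_def)
  show "\<one>\<^bsub>V\<^esub> \<in> torsion_fixed_mod r q"
    using V.one_closed by (auto simp: torsion_fixed_mod_def config_group_simps(3))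
  show "x \<otimes>\<^bsub>V\<^esub> y \<in> torsion_fixed_mod r q"
    if "x \<in> torsion_fixed_mod r q" "y \<in> torsion_fixed_mod r q" for x y
  proof -
    have "[(x \<otimes>\<^bsub>V\<^esub> y) (h i) = (x \<otimes>\<^bsub>V\<^esub> y) i] (mod q)" if "h \<in> G" "h ^^ r = id" for h i
    proof -
      have "[(x \<otimes>\<^bsub>V\<^esub> y) (h i) = x (h i) + y (h i)] (mod q)"
        by (rule cong_mult_config[OF assms])
      also have "[x (h i) + y (h i) = x i + y i] (mod q)"
        using \<open>x \<in> _\<close> \<open>y \<in> _\<close> that by (intro cong_add) (auto simp: torsion_fixed_mod_def)
      also have "[x i + y i = (x \<otimes>\<^bsub>V\<^esub> y) i] (mod q)"
        using cong_mult_config[OF assms] cong_sym by blast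
      finally show ?thesis .
    qed
    then show ?thesis
      using that by (auto simp: torsion_fixed_mod_def)
  qed
  show "perm_config s v \<in> torsion_fixed_mod r q" if "s \<in> S" "v \<in> torsion_fixed_mod r q" for s v
  proof -
    have sG: "s \<in> G"
      using that(1) S_subset_G by blast
    have "[perm_config s v (h i) = perm_config s v i] (mod q)" if h: "h \<in> G" "h ^^ r = id" for h i
    proof -
      \<comment> \<open>\<open>s v\<close> at \<open>h i\<close> is \<open>v\<close> at
        \<open>inv' s (h i)\<close>, which is \<open>?c\<close> applied to \<open>inv' s i\<close>;
        so invariance of \<open>s v\<close> under \<open>h\<close> is that of \<open>v\<close> under
        the conjugate \<open>?c\<close>.\<close>
      let ?c = "inv' s \<circ> h \<circ> s"
      have s: "s (inv' s j) = j" for j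
        using permutes_G[OF sG] permutes_inverses(1) by metis
      have pow: "s ((?c ^^ k) j) = (h ^^ k) (s j)" for k j
        by (induction k) (auto simp: s)
      have "(?c ^^ r) j = j" for j
        using pow[of r j] h(2) permutes_G[OF sG] by (simp add: permutes_inj inj_eq)
      then have "?c ^^ r = id"
        by auto
      moreover have "?c \<in> G"
        using sG h(1) comp_G inv_G by blast
      ultimately have "[v (?c (inv' s i)) = v (inv' s i)] (mod q)"
        using \<open>v \<in> _\<close> unfolding torsion_fixed_mod_def by blast
      then show ?thesis
        by (simp add: perm_config_def s)
    qed
    then show ?thesis
      using that sG by (auto simp: torsion_fixed_mod_def)
  qed
qed

text \<open>If \<open>h\<close> moves \<open>v\<close> by an \<open>h\<close>-invariant amount \<open>w\<close>, then \<open>h ^^ r = id\<close> forces \<open>r * w = 0\<close>,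
  hence \<open>w = 0\<close> modulo \<open>q\<close>.\<close>

lemma fixed_mod_torsion_fixed_mod:
  assumes "q dvd m" "coprime r q"
  shows "fixed_mod (torsion_fixed_mod r q) \<subseteq> torsion_fixed_mod r q"
proof
  fix v assume v: "v \<in> fixed_mod (torsion_fixed_mod r q)"
  then have vV: "v \<in> carrier V"
    by (simp add: fixed_mod_def)
  have "[v (h i) = v i] (mod q)" if h: "h \<in> G" "h ^^ r = id" for h i
  proof -
    \<comment> \<open>The inverse is taken because \<open>perm_config (inv' h) v\<close> is
      \<open>v \<circ> h\<close>, so that \<open>w\<close> is the increment of \<open>v\<close>
      along \<open>h\<close>.\<close>
    define w where "w = perm_config (inv' h) v \<otimes>\<^bsub>V\<^esub> inv\<^bsub>V\<^esub> v"
    have "w \<in> torsion_fixed_mod r q"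
      unfolding w_def
      using fixed_mod_perm_config_G[OF stable_torsion_fixed_mod[OF assms(1)] v inv_G[OF h(1)]] .
    then have w_inv: "[w (h j) = w j] (mod q)" for j
      using h by (auto simp: torsion_fixed_mod_def)
    have w_pow: "[w ((h ^^ k) i) = w i] (mod q)" for k
      by (induction k) (auto intro: cong_trans[OF w_inv])
    have "w \<otimes>\<^bsub>V\<^esub> v = perm_config (inv' h) v"
      using vV h(1) inv_G by (simp add: w_def V.m_assoc)
    then have "w \<otimes>\<^bsub>V\<^esub> v = v \<circ> h"
      using bij_G[OF h(1)] by (simp add: perm_config_def inv_inv_eq)
    then have vh: "[v (h j) = w j + v j] (mod q)" for j
      using cong_mult_config[OF assms(1), of w v j] by simp
    have "[v ((h ^^ k) i) = k * w i + v i] (mod q)" for k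
    proof (induction k)
      case (Suc k)
      have "[v ((h ^^ Suc k) i) = w ((h ^^ k) i) + v ((h ^^ k) i)] (mod q)"
        using vh by simp
      also have "[w ((h ^^ k) i) + v ((h ^^ k) i) = w i + (k * w i + v i)] (mod q)"
        using w_pow Suc by (rule cong_add)
      finally show ?case
        by (simp add: add.assoc)
    qed simp
    from this[of r] have "[r * w i + v i = 0 + v i] (mod q)"
      using h(2) by (simp add: cong_sym)
    then have "q dvd r * w i"
      by (metis cong_0_iff cong_add_rcancel_nat)
    then have "q dvd w i"
      using assms(2) by (simp add: coprime_commute coprime_dvd_mult_right_iff)
    then have "[w i + v i = 0 + v i] (mod q)"
      by (intro cong_add) (simp_all add: cong_0_iff)
    then show ?thesis
      using cong_trans[OF vh] by simp
  qed
  then show "v \<in> torsion_fixed_mod r q"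
    using vV by (auto simp: torsion_fixed_mod_def)
qed

text \<open>For \<open>r \<noteq> q\<close> the subgroup \<open>torsion_fixed_mod r q\<close> would
  be all of \<open>V\<close>, but Cauchy's theorem gives a nontrivial \<open>g\<close> with
  \<open>g ^^ r = id\<close>, and some unit vector is not fixed by it modulo
  \<open>q\<close>.\<close>

lemma no_proper_closed_imp_prime_divisors_eq:
  assumes closed: "\<And>U. stable U \<Longrightarrow> fixed_mod U \<subseteq> U \<Longrightarrow> U = carrier V"
    and "prime q" "q dvd m" "prime r" "r dvd card G"
  shows "r = q"
proof (rule ccontr)
  assume "r \<noteq> q"
  then have all: "torsion_fixed_mod r q = carrier V"
    using closed stable_torsion_fixed_mod fixed_mod_torsion_fixed_mod primes_coprime assms by metis
  let ?G = "sym_group n\<lparr>carrier := G\<rparr>"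
  interpret GG: group ?G
    using group.subgroup_imp_group[OF sym_group_is_group subgroup_G] .
  obtain g where g: "g \<in> G" "g \<noteq> id" "g [^]\<^bsub>?G\<^esub> r = id"
    using GG.cauchy_element[of r] finite_G assms(4,5) by (auto simp: order_def sym_group_one)
  have "g [^]\<^bsub>?G\<^esub> k = g ^^ k" for k
    by (induction k) (simp_all add: sym_group_def funpow_swap1 fun_eq_iff)
  then have "g ^^ r = id"
    using g(3) by simp
  obtain i where i: "g i \<noteq> i"
    using g(2) by (auto simp: fun_eq_iff)
  then have "i \<in> {1..n}"
    using permutes_G[OF g(1)] by (metis permutes_not_in)
  have "m > 1"
    using assms(2,3) m_pos prime_gt_1_nat[of q] dvd_imp_le[of q m] by simp
  \<comment> \<open>The unit vector at a point \<open>i\<close> moved by \<open>g\<close>: it is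
    \<open>1\<close> at \<open>i\<close> and \<open>0\<close> at \<open>g i\<close>. The value
    \<open>1\<close> is admissible because \<open>m > 1\<close>.\<close>
  define v :: "nat \<Rightarrow> nat" where "v = (\<lambda>j. if j = i then 1 else 0)"
  have "v \<in> torsion_fixed_mod r q"
    using \<open>m > 1\<close> \<open>i \<in> {1..n}\<close> unfolding all
    by (auto simp: config_group_simps valid_config_def v_def)
  then have "[v (g i) = v i] (mod q)"
    using g(1) \<open>g ^^ r = id\<close> unfolding torsion_fixed_mod_def by blast
  then show False
    using i prime_gt_1_nat[OF assms(2)] by (simp add: v_def cong_def)
qed

end

section \<open>From prime divisors to prime powers, and the characterization of winnable
  games\<close>

text \<open>Once all factors \<open>q\<close> are split off, the cofactor has no prime divisor left
  and must be 1.\<close>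

lemma unique_prime_divisor_imp_prime_power:
  fixes k q :: nat
  assumes "k > 0" "prime q" "\<And>r. prime r \<Longrightarrow> r dvd k \<Longrightarrow> r = q"
  obtains a where "k = q ^ a"
proof -
  have "\<not> is_unit q" "k \<noteq> 0"
    using assms(1,2) by auto
  then obtain l where l: "k = q ^ multiplicity q k * l" "\<not> q dvd l"
    using multiplicity_decompose'[of k q] by metis
  have "l = 1"
  proof (rule ccontr)
    assume "l \<noteq> 1"
    then obtain r where "prime r" "r dvd l"
      using prime_factor_nat by blast
    then show False
      using assms(3)[of r] l by (metis dvd_mult)
  qed
  then show thesis
    using that l(1) by simp
qed

theorem theorem1p2:
  fixes n m :: nat and S :: "(nat \<Rightarrow> nat) set"
  assumes "n > 0" and "m > 0"
    and "S \<subseteq> carrier (sym_group n)" and "id \<in> S"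
  shows "player_can_win n m S \<longleftrightarrow>
    (card (generate (sym_group n) S) = 1 \<or> m = 1 \<or>
     (\<exists>p a b. prime p \<and> a > 0 \<and> b > 0 \<and>
        card (generate (sym_group n) S) = p ^ a \<and> m = p ^ b))"
proof -
  interpret counter_game n m S
    using assms by unfold_locales
  have one_G: "id \<in> G"
    using assms(4) S_subset_G by blast
  have card_pos: "card G > 0"
    using finite_G one_G by (auto simp: card_gt_0_iff)
  show ?thesis (is "_ \<longleftrightarrow> ?cond")
  proof
    assume "player_can_win n m S"
    then have closed: "U = carrier V" if "stable U" "fixed_mod U \<subseteq> U" for U
      using player_can_win_imp_no_proper_closed that by blast
    show ?cond
    proof (cases "card G = 1 \<or> m = 1")
      case False
      then obtain q r where q: "prime q" "q dvd m" and r: "prime r" "r dvd card G"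
        using prime_factor_nat by metis
      \<comment> \<open>Every prime divisor of \<open>card G\<close> equals every prime divisor of
        \<open>m\<close>; as both numbers have one, a single prime is involved.\<close>
      have G_primes: "r' = q'" if "prime r'" "r' dvd card G" "prime q'" "q' dvd m" for r' q'
        using no_proper_closed_imp_prime_divisors_eq[OF closed] that by blast
      obtain a where a: "card G = q ^ a"
        using unique_prime_divisor_imp_prime_power[OF card_pos q(1)] G_primes q by metis
      obtain b where b: "m = q ^ b"
        using unique_prime_divisor_imp_prime_power[OF assms(2) q(1)] G_primes q r by metis
      have "a > 0" "b > 0"
        using a b False by (auto intro: gr0I)
      then show ?thesis
        using a b q by blast
    qed auto
  next
    assume cond: ?cond
    show "player_can_win n m S"
    proof (rule no_proper_closed_imp_player_can_win)
      fix U assume U: "stable U" "fixed_mod U \<subseteq> U"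
      consider p a b where "prime p" "card G = p ^ a" "m = p ^ b" | "m = 1" | "card G = 1"
        using cond by blast
      then show "U = carrier V"
      proof cases
        case 1
        then show ?thesis
          using p_group_no_proper_closed U by blast
      next
        case 2
        then have "card (carrier V) = 1"
          using order_config_group[of n m] by (simp add: order_def)
        then have "carrier V = {\<one>\<^bsub>V\<^esub>}"
          using V.one_closed by (metis card_1_singletonE singletonD)
        then show ?thesis
          using U(1) subgroup.one_closed[of U V] subgroup.subset[of U V] by (auto simp: stable_def)
      next
        case 3
        then have "G = {id}"
          using one_G by (metis card_1_singletonE singletonD)
        then have "S = {id}"
          using S_subset_G assms(4) by blast
        \<comment> \<open>With only the identity available every \<open>v\<close> satisfies
          \<open>s v - v = 0\<close>, so all of \<open>V\<close> is fixed modulo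
          \<open>U\<close>.\<close>
        then have "carrier V \<subseteq> fixed_mod U"
          using U(1) subgroup.one_closed[of U V] unfolding fixed_mod_def stable_def by auto
        then show ?thesis
          using U subgroup.subset[of U V] by (auto simp: stable_def)
      qed
    qed
  qed
qed

end
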